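(* Every connected amply regular graph, neither complete nor empty, with parameters $(n,d,\alpha,\beta)$ ($n=\infty$ allowed a priori) satisfying $\alpha\le 6\beta-9$ is finite. Moreover, for each fixed degree $d$, there are, up to isomorphism, only finitely many such graphs, i.e. only finitely many connected, non-complete, non-empty amply regular graphs of degree $d$ whose parameters satisfy $\alpha\le 6\beta-9$.
   Context: All graphs are simple and undirected. An amply regular graph with parameters $(n,d,\alpha,\beta)$ is a $d$-regular graph ($d$ finite) with $n$ vertices, $n=\infty$ being allowed, such that any two adjacent vertices have exactly $\alpha$ common neighbors and any two vertices at distance $2$ have exactly $\beta$ common neighbors. *)

theory Defs
  imports "Graph_Theory.Graph_Theory" "HOL-Library.Extended_Nat"
begin

text \<open>
  A simple undirected graph, finite or infinite, is a pair digraph \<open>G\<close> satisfying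
  \<^locale>\<open>pair_bidirected_digraph\<close>: its arc set is a symmetric irreflexive relation on
  \<open>pverts G\<close>, an edge being represented by its two orientations.
\<close>

definition common_neighbors :: "'a pair_pre_digraph \<Rightarrow> 'a \<Rightarrow> 'a \<Rightarrow> 'a set" where
  "common_neighbors G u v = {w \<in> pverts G. (u, w) \<in> parcs G \<and> (v, w) \<in> parcs G}"

definition graph_dist :: "'a pair_pre_digraph \<Rightarrow> 'a \<Rightarrow> 'a \<Rightarrow> ereal" where
  "graph_dist G u v = wf_digraph.\<mu> (with_proj G) (\<lambda>_. 1) u v"

definition graph_order :: "'a pair_pre_digraph \<Rightarrow> enat" where
  "graph_order G = (if finite (pverts G) then enat (card (pverts G)) else \<infinity>)"

text \<open>
  Finiteness of the arc sets is required separately, since \<^const>\<open>out_degree\<close> is \<open>0\<close>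
  at a vertex with infinitely many neighbours.
\<close>

definition regular_graph :: "'a pair_pre_digraph \<Rightarrow> nat \<Rightarrow> bool" where
  "regular_graph G d \<longleftrightarrow>
     (\<forall>v \<in> pverts G. finite (out_arcs (with_proj G) v) \<and> out_degree (with_proj G) v = d)"

definition amply_regular ::
    "'a pair_pre_digraph \<Rightarrow> enat \<Rightarrow> nat \<Rightarrow> nat \<Rightarrow> nat \<Rightarrow> bool" where
  "amply_regular G n d \<alpha> \<beta> \<longleftrightarrow>
     pair_bidirected_digraph G \<and>
     graph_order G = n \<and>
     regular_graph G d \<and>
     (\<forall>u v. (u, v) \<in> parcs G \<longrightarrow> card (common_neighbors G u v) = \<alpha>) \<and>
     (\<forall>u \<in> pverts G. \<forall>v \<in> pverts G.
        graph_dist G u v = 2 \<longrightarrow> card (common_neighbors G u v) = \<beta>)"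

definition complete_graph :: "'a pair_pre_digraph \<Rightarrow> bool" where
  "complete_graph G \<longleftrightarrow>
     (\<forall>u \<in> pverts G. \<forall>v \<in> pverts G. u \<noteq> v \<longrightarrow> (u, v) \<in> parcs G)"

definition empty_graph :: "'a pair_pre_digraph \<Rightarrow> bool" where
  "empty_graph G \<longleftrightarrow> parcs G = {}"

definition bounded_alpha_graphs :: "nat \<Rightarrow> 'a pair_pre_digraph set" where
  "bounded_alpha_graphs d =
     {G. connected (with_proj G) \<and> \<not> complete_graph G \<and> \<not> empty_graph G \<and>
         (\<exists>n \<alpha> \<beta>. amply_regular G n d \<alpha> \<beta> \<and> int \<alpha> \<le> 6 * int \<beta> - 9)}"

definition graph_iso_rel :: "('a pair_pre_digraph \<times> 'a pair_pre_digraph) set" where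
  "graph_iso_rel = {(G, H). digraph_iso (with_proj G) (with_proj H)}"

end

theory Submission
  imports "HOL-Analysis.Convex" Defs
begin

text \<open>
  The Bakry--Emery form \<open>\<Gamma>\<^sub>2\<close> at a vertex, minimised over the values of \<open>f\<close> on the second sphere, is a
  quadratic polynomial in the adjacency matrix of the local graph. Completing the square shows that
  it is positive definite, uniformly in the vertex, as soon as
  \<open>2 d (\<beta> - 2) + (\<alpha> + 4) \<beta> - \<alpha>\<^sup>2 > 0\<close>. If some vertex is the centre of a claw, then
  \<open>d \<ge> 3 \<alpha> + 6 - 3 \<beta>\<close>, and \<open>\<alpha> \<le> 6 \<beta> - 9\<close> suffices for this inequality. If the graph is claw-free and
  has diameter at least \<open>3\<close>, then the common neighbours of two suitable vertices at distance \<open>2\<close> form a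
  clique, which forces \<open>d = 2 \<alpha> + 3 - \<beta>\<close> and \<open>\<alpha> \<le> 3 \<beta> - 4\<close>, and the inequality holds again.

  Hence either the diameter is at most \<open>2\<close>, or the curvature is at least \<open>1 / d\<close> everywhere and a discrete
  heat flow started at a distance function bounds the diameter in terms of \<open>d\<close> alone. The order
  is then bounded in terms of \<open>d\<close>, which leaves finitely many isomorphism types.
\<close>

section \<open>The curvature form at a vertex\<close>

text \<open>Distance 2 is expressed through a shared neighbour, so the curvature computations
  involve no walks. \<open>nbr_sym\<close> and \<open>nbr_in\<close> force \<open>N x = {}\<close>
  for \<open>x\<close> outside \<open>V\<close>.\<close>

locale amply_regular_nbhd =
  fixes V :: "'a set" and N :: "'a \<Rightarrow> 'a set" and d \<alpha> \<beta> :: nat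
  assumes nbr_sym: "y \<in> N x \<Longrightarrow> x \<in> N y"
    and nbr_irrefl: "x \<notin> N x"
    and nbr_in: "y \<in> N x \<Longrightarrow> y \<in> V"
    and finite_nbr: "x \<in> V \<Longrightarrow> finite (N x)"
    and card_nbr: "x \<in> V \<Longrightarrow> card (N x) = d"
    and card_adjacent: "y \<in> N x \<Longrightarrow> card (N x \<inter> N y) = \<alpha>"
    and card_dist2: "\<lbrakk>x \<in> V; y \<in> V; x \<noteq> y; y \<notin> N x; N x \<inter> N y \<noteq> {}\<rbrakk> \<Longrightarrow> card (N x \<inter> N y) = \<beta>"
begin

text \<open>\<open>Gam\<close> is twice and \<open>Gam2\<close> four times the usual \<open>\<Gamma>\<close> and \<open>\<Gamma>\<^sub>2\<close> of the
  unnormalised Laplacian \<open>Lap\<close>.\<close>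

definition Lap :: "('a \<Rightarrow> real) \<Rightarrow> 'a \<Rightarrow> real" where
  "Lap f x = (\<Sum>y\<in>N x. f y - f x)"

definition Gam :: "('a \<Rightarrow> real) \<Rightarrow> 'a \<Rightarrow> real" where
  "Gam f x = (\<Sum>y\<in>N x. (f y - f x)\<^sup>2)"

definition Gam2 :: "('a \<Rightarrow> real) \<Rightarrow> 'a \<Rightarrow> real" where
  "Gam2 f x = Lap (Gam f) x - 2 * (\<Sum>y\<in>N x. (f y - f x) * (Lap f y - Lap f x))"

text \<open>On \<open>N x\<close> this is the adjacency operator of the local graph; at
  \<open>w = x\<close> it is the full sum over \<open>N x\<close>, and on the second sphere it runs
  over the common neighbours of \<open>x\<close> and \<open>w\<close>.\<close>

abbreviation nsum :: "'a \<Rightarrow> ('a \<Rightarrow> real) \<Rightarrow> 'a \<Rightarrow> real" where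
  "nsum x g w \<equiv> (\<Sum>y\<in>N x \<inter> N w. g y)"

text \<open>Sorting by the neighbours \<open>y\<close> leaves the double sum as the only term that
  sees the second sphere. Each \<open>y\<close> yields 3 d (g y)^2, of which the term - d
  \<open>Gam g x\<close> takes back one third.\<close>

lemma Gam2_expand:
  fixes g :: "'a \<Rightarrow> real"
  assumes x: "x \<in> V" and g0: "g x = 0"
  shows "Gam2 g x = (\<Sum>y\<in>N x. \<Sum>w\<in>N y. (g w)\<^sup>2 - 4 * g y * g w)
    + 2 * d * (\<Sum>y\<in>N x. (g y)\<^sup>2) + 2 * (\<Sum>y\<in>N x. g y)\<^sup>2"
proof -
  have Lx: "Lap g x = (\<Sum>y\<in>N x. g y)" and Gx: "Gam g x = (\<Sum>y\<in>N x. (g y)\<^sup>2)"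
    by (simp_all add: Lap_def Gam_def g0)
  have *: "Gam g y - 2 * g y * Lap g y
      = (\<Sum>w\<in>N y. (g w)\<^sup>2 - 4 * g y * g w) + 3 * d * (g y)\<^sup>2" if "y \<in> N x" for y
  proof -
    have y: "y \<in> V" using that nbr_in by blast
    have "Gam g y - 2 * g y * Lap g y
      = (\<Sum>w\<in>N y. (g w - g y)\<^sup>2 - 2 * g y * (g w - g y))"
      unfolding Lap_def Gam_def sum_distrib_left sum_subtractf[symmetric] ..
    also have "\<dots> = (\<Sum>w\<in>N y. ((g w)\<^sup>2 - 4 * g y * g w) + 3 * (g y)\<^sup>2)"
      by (intro sum.cong) (auto simp: power2_eq_square algebra_simps)
    also have "\<dots> = (\<Sum>w\<in>N y. (g w)\<^sup>2 - 4 * g y * g w) + 3 * d * (g y)\<^sup>2"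
      using y by (subst sum.distrib) (simp add: card_nbr)
    finally show ?thesis .
  qed
  have "Gam2 g x = (\<Sum>y\<in>N x. (Gam g y - 2 * g y * Lap g y) - Gam g x + 2 * Lap g x * g y)"
    unfolding Gam2_def Lap_def[of "Gam g" x]
    by (simp add: g0 sum_distrib_left algebra_simps sum_subtractf sum.distrib)
  also have "\<dots> = (\<Sum>y\<in>N x. Gam g y - 2 * g y * Lap g y) - d * Gam g x + 2 * Lap g x * (\<Sum>y\<in>N x. g y)"
    using x by (simp add: sum.distrib sum_subtractf sum_distrib_left card_nbr)
  also have "(\<Sum>y\<in>N x. Gam g y - 2 * g y * Lap g y) =
      (\<Sum>y\<in>N x. \<Sum>w\<in>N y. (g w)\<^sup>2 - 4 * g y * g w) + 3 * d * (\<Sum>y\<in>N x. (g y)\<^sup>2)"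
    using * by (simp add: sum.distrib sum_distrib_left)
  finally show ?thesis
    by (simp add: Lx Gx power2_eq_square algebra_simps)
qed

text \<open>These are the entries of A^2 = (d - \<beta>) I + (\<alpha> - \<beta>) A + \<beta> J on
  \<open>N x\<close>, with A the adjacency matrix and J the all-ones matrix: distinct nonadjacent
  neighbours of \<open>x\<close> share \<open>x\<close>, hence are at distance 2.\<close>

lemma card_common:
  assumes x: "x \<in> V" and y: "y \<in> N x" and y': "y' \<in> N x"
  shows "real (card (N y \<inter> N y')) = (if y' = y then real d - \<beta> else 0)
    + (if y' \<in> N y then real \<alpha> - \<beta> else 0) + \<beta>"
proof -
  have "y \<in> V" "y' \<in> V" "x \<in> N y \<inter> N y'" using y y' nbr_in nbr_sym by blast+
  then show ?thesis
    using card_nbr[of y] card_adjacent[of y' y] card_dist2[of y y'] nbr_irrefl[of y]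
    by (auto simp: Int_commute)
qed

text \<open>The left-hand side also counts the common neighbours of \<open>y\<close> and \<open>y'\<close> that lie in
  \<open>N x\<close> or equal \<open>x\<close>, so that it needs no inclusion-exclusion.\<close>

lemma sum_nsum_square:
  fixes g :: "'a \<Rightarrow> real"
  assumes x: "x \<in> V" and W: "finite W" "\<And>y. y \<in> N x \<Longrightarrow> N y \<subseteq> W"
  shows "(\<Sum>w\<in>W. (nsum x g w)\<^sup>2) = (real d - \<beta>) * (\<Sum>y\<in>N x. (g y)\<^sup>2)
    + (real \<alpha> - \<beta>) * (\<Sum>y\<in>N x. g y * nsum x g y) + \<beta> * (\<Sum>y\<in>N x. g y)\<^sup>2"
proof -
  have fin: "finite (N x)" using x finite_nbr by blast
  have "(\<Sum>w\<in>W. (nsum x g w)\<^sup>2)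
      = (\<Sum>w\<in>W. \<Sum>y\<in>N x. \<Sum>y'\<in>N x. if w \<in> N y \<inter> N y' then g y * g y' else 0)"
  proof (rule sum.cong[OF refl])
    fix w
    have "nsum x g w = (\<Sum>y\<in>N x. if w \<in> N y then g y else 0)"
      using fin nbr_sym by (subst sum.inter_restrict) (auto intro!: sum.cong)
    then show "(nsum x g w)\<^sup>2 = (\<Sum>y\<in>N x. \<Sum>y'\<in>N x. if w \<in> N y \<inter> N y' then g y * g y' else 0)"
      by (simp add: power2_eq_square sum_product) (auto intro!: sum.cong)
  qed
  \<comment> \<open>With \<open>w\<close> innermost, the sum counts the common neighbours of
    \<open>y\<close> and \<open>y'\<close>.\<close>
  also have "\<dots> = (\<Sum>y\<in>N x. \<Sum>y'\<in>N x. \<Sum>w\<in>W. if w \<in> N y \<inter> N y' then g y * g y' else 0)"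
    by (subst sum.swap, rule sum.cong[OF refl], rule sum.swap)
  also have "\<dots> = (\<Sum>y\<in>N x. \<Sum>y'\<in>N x. real (card (N y \<inter> N y')) * (g y * g y'))"
  proof (intro sum.cong refl)
    fix y y' assume "y \<in> N x"
    then have "W \<inter> (N y \<inter> N y') = N y \<inter> N y'" using W by blast
    then show "(\<Sum>w\<in>W. if w \<in> N y \<inter> N y' then g y * g y' else 0) = real (card (N y \<inter> N y')) * (g y * g y')"
      using W(1) by (subst sum.inter_restrict[symmetric]) auto
  qed
  also have "\<dots> = (\<Sum>y\<in>N x. \<Sum>y'\<in>N x. (if y' = y then (real d - \<beta>) * (g y)\<^sup>2 else 0)
     + (if y' \<in> N y then (real \<alpha> - \<beta>) * (g y * g y') else 0) + \<beta> * (g y * g y'))"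
    using x by (intro sum.cong refl) (auto simp: card_common power2_eq_square algebra_simps)
  also have "\<dots> = (\<Sum>y\<in>N x. (real d - \<beta>) * (g y)\<^sup>2 + (real \<alpha> - \<beta>) * (g y * nsum x g y)
     + \<beta> * (g y * (\<Sum>y\<in>N x. g y)))"
    using fin by (intro sum.cong refl) (simp add: sum.distrib sum.inter_restrict[symmetric] sum_distrib_left)
  also have "\<dots> = (real d - \<beta>) * (\<Sum>y\<in>N x. (g y)\<^sup>2)
    + (real \<alpha> - \<beta>) * (\<Sum>y\<in>N x. g y * nsum x g y) + \<beta> * (\<Sum>y\<in>N x. g y)\<^sup>2"
    by (simp add: sum.distrib sum_distrib_left[symmetric] sum_distrib_right[symmetric] power2_eq_square)
  finally show ?thesis .
qed

text \<open>Each \<open>y\<close> is counted once for each of its \<alpha> neighbours inside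
  \<open>N x\<close>.\<close>

lemma sum_nsum:
  fixes g :: "'a \<Rightarrow> real"
  assumes x: "x \<in> V"
  shows "(\<Sum>w\<in>N x. nsum x g w) = \<alpha> * (\<Sum>y\<in>N x. g y)"
proof -
  have fin: "finite (N x)" using x finite_nbr by blast
  have "(\<Sum>w\<in>N x. nsum x g w) = (\<Sum>w\<in>N x. \<Sum>y\<in>{y \<in> N x. w \<in> N y}. g y)"
    by (intro sum.cong refl) (use nbr_sym in auto)
  also have "\<dots> = (\<Sum>y\<in>N x. \<Sum>w\<in>{w \<in> N x. w \<in> N y}. g y)"
    using fin by (intro sum.swap_restrict)
  also have "\<dots> = (\<Sum>y\<in>N x. \<alpha> * g y)"
    using card_adjacent[of _ x] by (intro sum.cong refl) (simp add: Collect_conj_eq)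
  finally show ?thesis by (simp add: sum_distrib_left)
qed

text \<open>\<open>T\<close> is the second sphere. Grouped by the end point \<open>w\<close>, the
  number of middle vertices is \<alpha> on \<open>N x\<close> and \<beta> on \<open>T\<close>; the
  end point \<open>x\<close> drops out because \<open>g x = 0\<close>.\<close>

lemma sum_sphere2:
  fixes g :: "'a \<Rightarrow> real"
  assumes x: "x \<in> V" and g0: "g x = 0"
    and T: "T = (\<Union>y\<in>N x. N y) - N x - {x}"
  shows "(\<Sum>y\<in>N x. \<Sum>w\<in>N y. (g w)\<^sup>2 - 4 * g y * g w)
    = (\<Sum>w\<in>N x. \<alpha> * (g w)\<^sup>2 - 4 * g w * nsum x g w) + (\<Sum>w\<in>T. \<beta> * (g w)\<^sup>2 - 4 * g w * nsum x g w)"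
proof -
  define W where "W = insert x (N x \<union> (\<Union>y\<in>N x. N y))"
  have fin: "finite (N x)" "finite W" "finite T"
    using x finite_nbr nbr_in by (auto simp: W_def T)
  have "(\<Sum>y\<in>N x. \<Sum>w\<in>N y. (g w)\<^sup>2 - 4 * g y * g w)
      = (\<Sum>y\<in>N x. \<Sum>w\<in>{w \<in> W. w \<in> N y}. (g w)\<^sup>2 - 4 * g y * g w)"
    by (intro sum.cong refl) (auto simp: W_def)
  also have "\<dots> = (\<Sum>w\<in>W. \<Sum>y\<in>{y \<in> N x. w \<in> N y}. (g w)\<^sup>2 - 4 * g y * g w)"
    using fin by (intro sum.swap_restrict)
  also have "\<dots> = (\<Sum>w\<in>W. card (N x \<inter> N w) * (g w)\<^sup>2 - 4 * g w * nsum x g w)"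
  proof (intro sum.cong refl)
    fix w
    have "{y \<in> N x. w \<in> N y} = N x \<inter> N w" using nbr_sym by blast
    then show "(\<Sum>y\<in>{y \<in> N x. w \<in> N y}. (g w)\<^sup>2 - 4 * g y * g w)
        = card (N x \<inter> N w) * (g w)\<^sup>2 - 4 * g w * nsum x g w"
      by (simp add: sum_subtractf sum_distrib_left algebra_simps)
  qed
  also have "W = insert x (N x \<union> T)" by (auto simp: W_def T)
  also have "(\<Sum>w\<in>insert x (N x \<union> T). card (N x \<inter> N w) * (g w)\<^sup>2 - 4 * g w * nsum x g w)
     = (\<Sum>w\<in>N x \<union> T. card (N x \<inter> N w) * (g w)\<^sup>2 - 4 * g w * nsum x g w)"
    using fin nbr_irrefl[of x] by (subst sum.insert) (auto simp: T g0)
  also have "\<dots> = (\<Sum>w\<in>N x. card (N x \<inter> N w) * (g w)\<^sup>2 - 4 * g w * nsum x g w)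
     + (\<Sum>w\<in>T. card (N x \<inter> N w) * (g w)\<^sup>2 - 4 * g w * nsum x g w)"
    using fin by (intro sum.union_disjoint) (auto simp: T)
  also have "(\<Sum>w\<in>N x. card (N x \<inter> N w) * (g w)\<^sup>2 - 4 * g w * nsum x g w)
     = (\<Sum>w\<in>N x. \<alpha> * (g w)\<^sup>2 - 4 * g w * nsum x g w)"
    by (intro sum.cong refl) (simp add: card_adjacent)
  also have "(\<Sum>w\<in>T. card (N x \<inter> N w) * (g w)\<^sup>2 - 4 * g w * nsum x g w)
     = (\<Sum>w\<in>T. \<beta> * (g w)\<^sup>2 - 4 * g w * nsum x g w)"
  proof (intro sum.cong refl)
    fix w assume "w \<in> T"
    then have "card (N x \<inter> N w) = \<beta>"
      using x nbr_in nbr_sym by (intro card_dist2) (auto simp: T)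
    then show "card (N x \<inter> N w) * (g w)\<^sup>2 - 4 * g w * nsum x g w = \<beta> * (g w)\<^sup>2 - 4 * g w * nsum x g w"
      by simp
  qed
  finally show ?thesis .
qed

text \<open>A vertex w of the second sphere contributes \<beta> g(w)^2 - 4 g(w) S with S =
  \<open>nsum x g w\<close>, which is at least -4 S^2 / \<beta>, with equality at g(w) = 2 S /
  \<beta>. The sum of the S^2 over the second sphere is \<open>sum_nsum_square\<close> minus the
  shares of \<open>x\<close> and \<open>N x\<close>.\<close>

lemma Gam2_ge_quadratic_form:
  fixes g :: "'a \<Rightarrow> real" and Q s L R :: real
  assumes x: "x \<in> V" and g0: "g x = 0" and b: "\<beta> > 0"
  defines "Q \<equiv> \<Sum>y\<in>N x. (g y)\<^sup>2" and "s \<equiv> \<Sum>y\<in>N x. g y"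
    and "L \<equiv> \<Sum>y\<in>N x. g y * nsum x g y" and "R \<equiv> \<Sum>y\<in>N x. (nsum x g y)\<^sup>2"
  shows "\<beta> * Gam2 g x \<ge> \<beta> * (\<alpha> * Q - 4 * L + 2 * d * Q + 2 * s\<^sup>2)
     - 4 * ((real d - \<beta>) * Q + (real \<alpha> - \<beta>) * L + \<beta> * s\<^sup>2 - s\<^sup>2 - R)"
proof -
  define T where "T = (\<Union>y\<in>N x. N y) - N x - {x}"
  define W where "W = insert x (N x \<union> T)"
  have fin: "finite (N x)" "finite T"
    using x finite_nbr nbr_in by (auto simp: T_def)
  have "(\<Sum>w\<in>W. (nsum x g w)\<^sup>2) = s\<^sup>2 + R + (\<Sum>w\<in>T. (nsum x g w)\<^sup>2)"
  proof -
    have "(\<Sum>w\<in>W. (nsum x g w)\<^sup>2) = s\<^sup>2 + (\<Sum>w\<in>N x \<union> T. (nsum x g w)\<^sup>2)"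
      unfolding W_def using fin nbr_irrefl[of x] by (subst sum.insert) (auto simp: T_def s_def)
    also have "(\<Sum>w\<in>N x \<union> T. (nsum x g w)\<^sup>2) = R + (\<Sum>w\<in>T. (nsum x g w)\<^sup>2)"
      unfolding R_def using fin by (intro sum.union_disjoint) (auto simp: T_def)
    finally show ?thesis by simp
  qed
  moreover have "(\<Sum>w\<in>W. (nsum x g w)\<^sup>2) = (real d - \<beta>) * Q + (real \<alpha> - \<beta>) * L + \<beta> * s\<^sup>2"
    unfolding Q_def s_def L_def using x fin by (intro sum_nsum_square) (auto simp: W_def T_def)
  ultimately have T2: "(\<Sum>w\<in>T. (nsum x g w)\<^sup>2)
      = (real d - \<beta>) * Q + (real \<alpha> - \<beta>) * L + \<beta> * s\<^sup>2 - s\<^sup>2 - R"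
    by simp
  have T4: "- 4 * (\<Sum>w\<in>T. (nsum x g w)\<^sup>2) \<le> \<beta> * (\<Sum>w\<in>T. \<beta> * (g w)\<^sup>2 - 4 * g w * nsum x g w)"
    unfolding sum_distrib_left[where A = T]
  proof (rule sum_mono)
    fix w
    have "0 \<le> (\<beta> * g w - 2 * nsum x g w)\<^sup>2" by simp
    then show "- 4 * (nsum x g w)\<^sup>2 \<le> \<beta> * (\<beta> * (g w)\<^sup>2 - 4 * g w * nsum x g w)"
      by (simp add: power2_eq_square algebra_simps)
  qed
  have NQ: "(\<Sum>w\<in>N x. \<alpha> * (g w)\<^sup>2 - 4 * g w * nsum x g w) = \<alpha> * Q - 4 * L"
    by (simp add: Q_def L_def sum_subtractf sum_distrib_left mult.assoc)
  show ?thesis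
    using T4 unfolding Gam2_expand[where g = g, OF x g0] sum_sphere2[where g = g, OF x g0 T_def] T2[symmetric] NQ
    by (simp add: Q_def[symmetric] s_def[symmetric] algebra_simps)
qed

text \<open>The upper bounds on \<open>\<kappa>\<close> say that the quadratic form is at least \<open>\<kappa>\<close> on the orthogonal
  complement of the constants, where a square is completed in the adjacency matrix of the local
  graph, and on the constants themselves.\<close>

lemma Gam2_ge_normalised:
  fixes g :: "'a \<Rightarrow> real" and \<kappa> :: real
  assumes x: "x \<in> V" and g0: "g x = 0" and b: "\<beta> > 0" and d: "d > 0"
    and k1: "\<beta> * \<kappa> \<le> 2 * d * (real \<beta> - 2) + (\<alpha> + 4) * \<beta> - (real \<alpha>)\<^sup>2" and k2: "\<kappa> \<le> \<alpha> + 4"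
  shows "Gam2 g x \<ge> \<kappa> * (\<Sum>y\<in>N x. (g y)\<^sup>2)"
proof -
  define Q s L R where "Q = (\<Sum>y\<in>N x. (g y)\<^sup>2)" and "s = (\<Sum>y\<in>N x. g y)"
    and "L = (\<Sum>y\<in>N x. g y * nsum x g y)" and "R = (\<Sum>y\<in>N x. (nsum x g y)\<^sup>2)"
  have CS: "(\<Sum>y\<in>N x. h y)\<^sup>2 \<le> d * (\<Sum>y\<in>N x. (h y)\<^sup>2)" for h :: "'a \<Rightarrow> real"
    using sum_squared_le_sum_of_squares[of h "N x"] x by (simp add: card_nbr mult.commute)
  have sQ: "s\<^sup>2 \<le> d * Q" unfolding s_def Q_def by (rule CS)
  \<comment> \<open>The terms 4 R - 4 \<alpha> L are 4 times the squared norm of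
    \<open>nsum x g y - \<alpha> / 2 * g y\<close>, minus \<alpha>^2 Q. Cauchy-Schwarz bounds that
    norm below by its constant component instead of by 0.\<close>
  have e1: "(\<Sum>y\<in>N x. nsum x g y - \<alpha> / 2 * g y) = \<alpha> / 2 * s"
    using sum_nsum[OF x, of g] unfolding sum_subtractf sum_distrib_left[symmetric] by (simp add: s_def)
  have e2: "(\<Sum>y\<in>N x. (nsum x g y - \<alpha> / 2 * g y)\<^sup>2) = R - \<alpha> * L + (real \<alpha>)\<^sup>2 / 4 * Q"
    unfolding R_def L_def Q_def sum_distrib_left[where A = "N x"] sum.distrib[symmetric] sum_subtractf[symmetric]
    by (intro sum.cong refl) (simp add: power2_eq_square algebra_simps)
  have RL: "(\<alpha> / 2 * s)\<^sup>2 \<le> d * (R - \<alpha> * L + (real \<alpha>)\<^sup>2 / 4 * Q)"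
    using CS[of "\<lambda>y. nsum x g y - \<alpha> / 2 * g y"] unfolding e1 e2 .
  define c where "c = 2 * d * (real \<beta> - 2) + (\<alpha> + 4) * \<beta> - (real \<alpha>)\<^sup>2"
  have G: "\<beta> * Gam2 g x \<ge> c * Q + 4 * (R - \<alpha> * L + (real \<alpha>)\<^sup>2 / 4 * Q) - (2 * real \<beta> - 4) * s\<^sup>2"
    using Gam2_ge_quadratic_form[where g = g, OF x g0 b] unfolding Q_def[symmetric] s_def[symmetric] L_def[symmetric] R_def[symmetric] c_def
    by (simp add: power2_eq_square algebra_simps)
  have "d * (\<beta> * Gam2 g x) \<ge> d * (c * Q + 4 * (R - \<alpha> * L + (real \<alpha>)\<^sup>2 / 4 * Q) - (2 * real \<beta> - 4) * s\<^sup>2)"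
    using G by (intro mult_left_mono) auto
  then have "d * (\<beta> * Gam2 g x) \<ge> c * (d * Q) + (real \<alpha>)\<^sup>2 * s\<^sup>2 - d * (2 * real \<beta> - 4) * s\<^sup>2"
    using RL by (simp add: power2_eq_square algebra_simps)
  \<comment> \<open>d Q - s^2 is d times the squared norm of the part of \<open>g\<close> orthogonal
    to the constants. In the remaining coefficient of s^2 the terms with d and \<alpha>^2
    cancel.\<close>
  also have "c * (d * Q) + (real \<alpha>)\<^sup>2 * s\<^sup>2 - d * (2 * real \<beta> - 4) * s\<^sup>2
      = c * (d * Q - s\<^sup>2) + \<beta> * (\<alpha> + 4) * s\<^sup>2"
    by (simp add: c_def algebra_simps)
  finally have "d * (\<beta> * Gam2 g x) \<ge> c * (d * Q - s\<^sup>2) + \<beta> * (\<alpha> + 4) * s\<^sup>2" .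
  moreover have "c * (d * Q - s\<^sup>2) \<ge> \<beta> * \<kappa> * (d * Q - s\<^sup>2)"
    using k1 sQ unfolding c_def by (intro mult_right_mono) auto
  moreover have "\<beta> * (\<alpha> + 4) * s\<^sup>2 \<ge> \<beta> * \<kappa> * s\<^sup>2"
    using k2 by (simp add: mult_left_mono mult_right_mono)
  ultimately have "(d * \<beta>) * Gam2 g x \<ge> (d * \<beta>) * (\<kappa> * Q)"
    by (simp add: algebra_simps)
  then show ?thesis using b d by (simp add: Q_def)
qed

lemma Gam2_ge:
  fixes \<kappa> :: real
  assumes x: "x \<in> V" and b: "\<beta> > 0" and d: "d > 0"
    and k1: "\<beta> * \<kappa> \<le> 2 * d * (real \<beta> - 2) + (\<alpha> + 4) * \<beta> - (real \<alpha>)\<^sup>2" and k2: "\<kappa> \<le> \<alpha> + 4"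
  shows "Gam2 f x \<ge> \<kappa> * Gam f x"
proof -
  define g where "g y = f y - f x" for y
  have "Lap g = Lap f" "Gam g = Gam f"
    by (auto simp: fun_eq_iff Lap_def Gam_def g_def)
  then have "Gam2 f x = Gam2 g x" by (simp add: Gam2_def g_def)
  also have "\<dots> \<ge> \<kappa> * (\<Sum>y\<in>N x. (g y)\<^sup>2)"
    using assms by (intro Gam2_ge_normalised) (auto simp: g_def)
  finally show ?thesis by (simp add: Gam_def g_def)
qed

end

section \<open>Positivity of the curvature\<close>

text \<open>If a \<le> b, then a^2 \<le> a b already leaves 4 b. Otherwise inserting the bound on d
  leaves (a - b) (6 b - 9 - a) + (19 b - 3 a - 24), whose last bracket is at least b + 3; the
  product shows the role of 6 b - 9.\<close>

lemma claw_curvature: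
  fixes a b d :: int
  assumes d: "3 * a + 6 \<le> d + 3 * b" and b: "b \<ge> 2" and a: "0 \<le> a" "a \<le> 6 * b - 9" and d0: "0 \<le> d"
  shows "1 \<le> 2 * d * (b - 2) + (a + 4) * b - a\<^sup>2"
proof (cases "a \<le> b")
  case True
  have "a * a \<le> a * b" using a True by (intro mult_left_mono)
  moreover have "0 \<le> d * (b - 2)" using d0 b by simp
  ultimately show ?thesis using b by (simp add: power2_eq_square algebra_simps)
next
  case False
  have "2 * (b - 2) * (3 * a + 6 - 3 * b) \<le> 2 * (b - 2) * d" using d b by (intro mult_left_mono) auto
  moreover have "0 \<le> (a - b) * (6 * b - 9 - a)" using False a by simp
  ultimately show ?thesis using a b by (simp add: power2_eq_square algebra_simps)
qed

text \<open>Eliminating d leaves a (5 b - 8 - a) - 2 b^2 + 14 b - 12. The two factors of the product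
  are at least b - 1 and 2 b - 4, so the total is at least 8 b - 8.\<close>

lemma claw_free_curvature:
  fixes a b d :: int
  assumes d: "d + b = 2 * a + 3" and ab: "a + 4 \<le> 3 * b" "b \<le> a + 1" and b: "b \<ge> 2"
  shows "1 \<le> 2 * d * (b - 2) + (a + 4) * b - a\<^sup>2"
proof -
  have "(b - 1) * (2 * b - 4) \<le> a * (5 * b - 8 - a)" using ab b by (intro mult_mono) auto
  moreover have d_eq: "d = 2 * a + 3 - b" using d by simp
  ultimately show ?thesis using b unfolding d_eq by (simp add: power2_eq_square algebra_simps)
qed

section \<open>Claws and the parameters\<close>

context amply_regular_nbhd begin

text \<open>The closed neighbourhoods of the three leaves inside \<open>N p\<close> have \<alpha> +
  1 elements each. Two of them meet in at most \<beta> - 1 vertices, as \<open>p\<close> is a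
  further common neighbour of the leaves. Inclusion-exclusion inside \<open>N p\<close> gives the
  bound.\<close>

lemma claw_degree_ge:
  assumes p: "p \<in> V" and abc: "a \<in> N p" "b \<in> N p" "c \<in> N p"
    and ne: "a \<noteq> b" "a \<noteq> c" "b \<noteq> c" and na: "b \<notin> N a" "c \<notin> N a" "c \<notin> N b"
  shows "3 * \<alpha> + 6 \<le> d + 3 * \<beta>"
proof -
  define A where "A q = insert q (N p \<inter> N q)" for q
  have finN: "finite (N p)" using p finite_nbr by blast
  have A: "finite (A q)" "A q \<subseteq> N p" "card (A q) = \<alpha> + 1" if "q \<in> N p" for q
    using that finN card_adjacent[of q p] nbr_irrefl[of q] by (auto simp: A_def)
  have I: "card (A q \<inter> A r) + 1 \<le> \<beta>" if "q \<in> N p" "r \<in> N p" "q \<noteq> r" "r \<notin> N q" for q r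
  proof -
    have V: "q \<in> V" "r \<in> V" and pq: "p \<in> N q \<inter> N r" using that nbr_in nbr_sym by blast+
    have "insert p (A q \<inter> A r) \<subseteq> N q \<inter> N r" "p \<notin> A q \<inter> A r"
      using that pq nbr_sym nbr_irrefl[of p] by (auto simp: A_def)
    moreover have "finite (N q \<inter> N r)" using V finite_nbr by blast
    ultimately have "card (A q \<inter> A r) + 1 \<le> card (N q \<inter> N r)"
      using card_mono[of "N q \<inter> N r" "insert p (A q \<inter> A r)"] that A by simp
    also have "\<dots> = \<beta>" using that V pq by (intro card_dist2) auto
    finally show ?thesis .
  qed
  have "card (A a \<union> A b \<union> A c) \<le> d"
    using card_mono[of "N p" "A a \<union> A b \<union> A c"] finN A abc p by (simp add: card_nbr)
  moreover have "card (A a) + card (A b) = card (A a \<union> A b) + card (A a \<inter> A b)"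
    using A abc by (intro card_Un_Int)
  moreover have "card (A a \<union> A b) + card (A c) = card (A a \<union> A b \<union> A c) + card ((A a \<union> A b) \<inter> A c)"
    using A abc by (intro card_Un_Int) auto
  moreover have "card ((A a \<union> A b) \<inter> A c) \<le> card (A a \<inter> A c) + card (A b \<inter> A c)"
    unfolding Int_Un_distrib2 by (rule card_Un_le)
  ultimately show ?thesis
    using A(3)[OF abc(1)] A(3)[OF abc(2)] A(3)[OF abc(3)] I[of a b] I[of a c] I[of b c] abc ne na by simp
qed

text \<open>\<open>z\<close>, \<open>x\<close>, \<open>y\<close>, \<open>v\<close> is a geodesic.
  The common neighbours of \<open>y\<close> and \<open>z\<close> form a clique, so those other than
  \<open>x\<close> make a set \<open>M\<close> inside \<open>N x\<close> of size \<beta> - 1.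
  Together with \<open>y\<close>, \<open>z\<close> and two sets \<open>Y\<close>, \<open>Z\<close>
  of size \<alpha> - \<beta> + 1 it partitions \<open>N x\<close>. The bound on \<alpha> comes from
  counting around a vertex \<open>t\<close> of \<open>M\<close>.\<close>

lemma claw_free_parameters:
  assumes z: "z \<in> V" and x: "x \<in> N z" and y: "y \<in> N x" and v: "v \<in> N y"
    and yz: "y \<noteq> z" "y \<notin> N z" and vz: "v \<notin> N z" "N z \<inter> N v = {}" and b: "\<beta> \<ge> 2"
    and claw_free: "\<And>p a b c. \<lbrakk>p \<in> V; a \<in> N p; b \<in> N p; c \<in> N p; a \<noteq> b; a \<noteq> c; b \<noteq> c;
      b \<notin> N a; c \<notin> N a\<rbrakk> \<Longrightarrow> c \<in> N b"
  shows "d + \<beta> = 2 * \<alpha> + 3" "\<alpha> + 4 \<le> 3 * \<beta>" "\<beta> \<le> \<alpha> + 1"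
proof -
  have V: "x \<in> V" "y \<in> V" "v \<in> V" using x y v nbr_in by blast+
  have zx: "z \<in> N x" and xy: "x \<in> N y" using x y nbr_sym by blast+
  have fin: "finite (N x)" "finite (N y)" "finite (N z)" using V z finite_nbr by auto
  \<comment> \<open>Otherwise the two common neighbours and \<open>v\<close> form a claw at \<open>y\<close>.\<close>
  have clique: "w' \<in> N w" if "w \<in> N y \<inter> N z" "w' \<in> N y \<inter> N z" "w \<noteq> w'" for w w'
  proof -
    have "v \<noteq> w" "v \<noteq> w'" "w \<notin> N v" "w' \<notin> N v" using that vz by auto
    then show ?thesis using claw_free[of y v w w'] V v that by blast
  qed
  define M where "M = N y \<inter> N z - {x}"
  define Y where "Y = N x \<inter> N y - N z"
  define Z where "Z = N x \<inter> N z - N y"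
  have finS: "finite M" "finite Y" "finite Z" using fin by (auto simp: M_def Y_def Z_def)
  have Mx: "M \<subseteq> N x" using clique[of x] xy x by (auto simp: M_def)
  have "card (N y \<inter> N z) = \<beta>"
    using V z yz xy x nbr_sym[of z y] by (intro card_dist2) auto
  then have cM: "card M + 1 = \<beta>" using xy x b fin by (simp add: M_def)
  have "N x \<inter> N y = Y \<union> M" using Mx nbr_irrefl[of x] by (auto simp: M_def Y_def)
  then have "card (Y \<union> M) = \<alpha>" using card_adjacent[OF y] by simp
  then have cY: "card Y + card M = \<alpha>"
    using finS by (subst (asm) card_Un_disjoint) (auto simp: M_def Y_def)
  have "N x \<inter> N z = Z \<union> M" using Mx nbr_irrefl[of x] by (auto simp: M_def Z_def)
  then have "card (Z \<union> M) = \<alpha>" using card_adjacent[OF zx] by simp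
  then have cZ: "card Z + card M = \<alpha>"
    using finS by (subst (asm) card_Un_disjoint) (auto simp: M_def Z_def)
  \<comment> \<open>\<open>y\<close> and \<open>z\<close> are nonadjacent neighbours of
    \<open>x\<close>; a vertex adjacent to neither would complete a claw at
    \<open>x\<close>.\<close>
  have cover: "w \<in> N y \<or> w \<in> N z" if "w \<in> N x" "w \<noteq> y" "w \<noteq> z" for w
    using claw_free[of x y z w] that V y zx yz nbr_sym by blast
  have notin: "y \<notin> Y" "y \<notin> Z" "y \<notin> M" "z \<notin> Y" "z \<notin> Z" "z \<notin> M"
    using nbr_irrefl nbr_sym yz by (auto simp: Y_def Z_def M_def)
  have disj: "Y \<inter> Z = {}" "(Y \<union> Z) \<inter> M = {}" by (auto simp: Y_def Z_def M_def)
  have "N x = insert y (insert z (Y \<union> Z \<union> M))"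
    using cover Mx y zx nbr_irrefl[of x] by (auto simp: Y_def Z_def M_def)
  then have "d = card (insert y (insert z (Y \<union> Z \<union> M)))" using card_nbr[OF V(1)] by simp
  also have "\<dots> = 2 + (card Y + card Z + card M)"
    using finS notin yz disj by (simp add: card_Un_disjoint)
  finally have cd: "d = 2 + (card Y + card Z + card M)" .
  show "d + \<beta> = 2 * \<alpha> + 3" using cd cY cZ cM by simp
  show "\<beta> \<le> \<alpha> + 1" using cM cY by simp
  have "M \<noteq> {}" using cM b by auto
  then obtain t where t: "t \<in> M" by blast
  have tx: "t \<in> N x" using t Mx by blast
  have tyz: "y \<in> N t" "z \<in> N t" using t nbr_sym by (auto simp: M_def)
  have "N x \<inter> N t = insert y (insert z ((Y \<inter> N t) \<union> (Z \<inter> N t) \<union> (M - {t})))"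
  proof
    show "N x \<inter> N t \<subseteq> insert y (insert z ((Y \<inter> N t) \<union> (Z \<inter> N t) \<union> (M - {t})))"
      using cover nbr_irrefl[of t] nbr_irrefl[of x] by (auto simp: Y_def Z_def M_def)
    show "insert y (insert z ((Y \<inter> N t) \<union> (Z \<inter> N t) \<union> (M - {t}))) \<subseteq> N x \<inter> N t"
      using y zx tyz Mx clique[of t] t by (auto simp: Y_def Z_def M_def)
  qed
  then have "\<alpha> = card (insert y (insert z ((Y \<inter> N t) \<union> (Z \<inter> N t) \<union> (M - {t}))))"
    using card_adjacent[OF tx] by simp
  also have "\<dots> = 2 + (card ((Y \<inter> N t) \<union> (Z \<inter> N t) \<union> (M - {t})))"
    using finS notin yz by simp
  also have "card ((Y \<inter> N t) \<union> (Z \<inter> N t) \<union> (M - {t})) = card (Y \<inter> N t) + card (Z \<inter> N t) + card (M - {t})"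
    using finS disj by (subst card_Un_disjoint, simp, simp, blast, subst card_Un_disjoint, simp, simp, blast) simp
  finally have ct: "\<alpha> + 1 = 2 + (card (Y \<inter> N t) + card (Z \<inter> N t) + card M)"
    using t finS cM b by simp
  have cY': "card Y = card (Y \<inter> N t) + card (Y - N t)"
    using finS by (metis card_Int_Diff)
  have cZ': "card Z = card (Z \<inter> N t) + card (Z - N t)"
    using finS by (metis card_Int_Diff)
  \<comment> \<open>\<open>Y \<inter> N t\<close> and \<open>Z \<inter> N t\<close> together have
    \<alpha> - \<beta> elements, one fewer than \<open>Y\<close> or \<open>Z\<close> alone.\<close>
  have "card (Y - N t) > 0" "card (Z - N t) > 0"
    using ct cY cZ cY' cZ' by linarith+
  then have "Y - N t \<noteq> {}" "Z - N t \<noteq> {}"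
    unfolding card_gt_0_iff by blast+
  then obtain w w' where w: "w \<in> Y - N t" and w': "w' \<in> Z - N t" by blast
  \<comment> \<open>Otherwise \<open>t\<close>, \<open>p\<close> and \<open>q\<close> would form a
    claw at \<open>x\<close>.\<close>
  have join: "q \<in> N p" if "p \<in> Y - N t" "q \<in> Z - N t" for p q
  proof -
    have "t \<in> N y" "t \<in> N z" using t by (auto simp: M_def)
    then have "p \<in> N x" "q \<in> N x" "p \<noteq> q" "t \<noteq> p" "t \<noteq> q" "p \<notin> N t" "q \<notin> N t"
      using that by (auto simp: Y_def Z_def)
    then show ?thesis using claw_free[of x t p q] V tx by blast
  qed
  \<comment> \<open>\<open>x\<close> is one of the \<beta> common neighbours of \<open>r\<close> and
    \<open>q\<close>, which leaves \<beta> - 1 = \<open>card M\<close> for \<open>S\<close>.\<close>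
  have bound: "card S \<le> card M" if "S \<subseteq> N r \<inter> N q" "x \<notin> S" "r \<in> N x" "q \<in> N x" "r \<noteq> q" "q \<notin> N r" for S r q
  proof -
    have V': "r \<in> V" "q \<in> V" and xx: "x \<in> N r \<inter> N q" using that nbr_in nbr_sym by blast+
    have fin': "finite (N r \<inter> N q)" using V' finite_nbr by blast
    have "card (insert x S) \<le> card (N r \<inter> N q)"
      using fin' by (rule card_mono) (use that xx in blast)
    moreover have "finite S" using that(1) fin' by (rule finite_subset)
    moreover have "card (N r \<inter> N q) = \<beta>" using that V' xx by (intro card_dist2) auto
    ultimately show ?thesis using that cM by simp
  qed
  have "card (Z - N t) \<le> card M"
  proof (rule bound[of _ w z])
    show "Z - N t \<subseteq> N w \<inter> N z" using join[OF w] by (auto simp: Z_def)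
    show "x \<notin> Z - N t" "w \<in> N x" "z \<in> N x" "w \<noteq> z" "z \<notin> N w"
      using w nbr_irrefl[of x] zx notin nbr_sym[of z w] by (auto simp: Y_def Z_def)
  qed
  moreover have "card (Y - N t) \<le> card M"
  proof (rule bound[of _ w' y])
    show "Y - N t \<subseteq> N w' \<inter> N y" using join[OF _ w'] nbr_sym by (auto simp: Y_def)
    show "x \<notin> Y - N t" "w' \<in> N x" "y \<in> N x" "w' \<noteq> y" "y \<notin> N w'"
      using w' nbr_irrefl[of x] y notin nbr_sym[of y w'] by (auto simp: Y_def Z_def)
  qed
  \<comment> \<open>The two differences have 2 (\<alpha> - \<beta> + 1) - (\<alpha> - \<beta>) =
    \<alpha> - \<beta> + 2 elements in total, and at most 2 (\<beta> - 1).\<close>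
  ultimately show "\<alpha> + 4 \<le> 3 * \<beta>" using ct cY cZ cY' cZ' cM by simp
qed

text \<open>A claw at any vertex suffices for the first case, because the parameters are the same
  everywhere.\<close>

lemma geodesic3_curvature:
  assumes z: "z \<in> V" and x: "x \<in> N z" and y: "y \<in> N x" and v: "v \<in> N y"
    and yz: "y \<noteq> z" "y \<notin> N z" and vz: "v \<notin> N z" "N z \<inter> N v = {}"
    and ab: "int \<alpha> \<le> 6 * int \<beta> - 9"
  shows "1 \<le> 2 * int d * (int \<beta> - 2) + (int \<alpha> + 4) * int \<beta> - (int \<alpha>)\<^sup>2"
proof (cases "\<exists>p\<in>V. \<exists>a\<in>N p. \<exists>b\<in>N p. \<exists>c\<in>N p. a \<noteq> b \<and> a \<noteq> c \<and> b \<noteq> c \<and> b \<notin> N a \<and> c \<notin> N a \<and> c \<notin> N b")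
  case True
  then have "3 * \<alpha> + 6 \<le> d + 3 * \<beta>" using claw_degree_ge by blast
  then show ?thesis using ab by (intro claw_curvature) auto
next
  case False
  have "\<beta> \<ge> 2" using ab by simp
  then have "d + \<beta> = 2 * \<alpha> + 3" "\<alpha> + 4 \<le> 3 * \<beta>" "\<beta> \<le> \<alpha> + 1"
    using claw_free_parameters[OF z x y v yz vz] False by blast+
  then show ?thesis using ab by (intro claw_free_curvature) auto
qed

end

section \<open>Heat flow and the diameter\<close>

text \<open>The real number is the total displacement 2 \<epsilon> d / (1 - r) found in
  \<open>lipschitz_bounded\<close>; the maximum with 2 covers graphs without a geodesic of length 3,
  for which no curvature bound is derived.\<close>

definition diameter_bound :: "nat \<Rightarrow> nat" where
  "diameter_bound d = max 2 (nat \<lfloor>1 / (4 * (real d)\<^sup>2 * (1 - sqrt (1 - 1 / (16 * real d ^ 4))))\<rfloor>)"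

definition order_bound :: "nat \<Rightarrow> nat" where
  "order_bound d = (\<Sum>k\<le>diameter_bound d. d ^ k)"

section \<open>Gradient decay under the discrete heat flow\<close>

context amply_regular_nbhd begin

lemma Lap_square_le:
  assumes "x \<in> V"
  shows "(Lap f x)\<^sup>2 \<le> d * Gam f x"
  using sum_squared_le_sum_of_squares[of "\<lambda>y. f y - f x" "N x"] assms
  by (simp add: Lap_def Gam_def card_nbr mult.commute)

lemma diff_square_le_Gam:
  assumes "x \<in> V" "y \<in> N x"
  shows "(f y - f x)\<^sup>2 \<le> Gam f x"
  unfolding Gam_def using assms finite_nbr by (intro member_le_sum) auto

text \<open>An explicit Euler step of the heat equation.\<close>

definition heat_step :: "real \<Rightarrow> ('a \<Rightarrow> real) \<Rightarrow> 'a \<Rightarrow> real" where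
  "heat_step \<epsilon> f x = f x + \<epsilon> * Lap f x"

text \<open>The first-order change is 2 \<epsilon> X, where 2 X is
  \<open>Lap (Gam f) x - Gam2 f x\<close>, bounded by the curvature and by \<open>M\<close>. The
  condition \<epsilon> (d + \<kappa>) \<le> 1 keeps the coefficient of \<open>Gam f x\<close>
  nonnegative, so that \<open>M\<close> may replace \<open>Gam f x\<close>.\<close>

lemma Gam_heat_step:
  fixes \<kappa> \<epsilon> M :: real
  assumes curv: "Gam2 f x \<ge> \<kappa> * Gam f x" and x: "x \<in> V"
    and M: "\<And>y. y \<in> V \<Longrightarrow> Gam f y \<le> M"
    and e: "0 \<le> \<epsilon>" "\<epsilon> * (d + \<kappa>) \<le> 1"
  shows "Gam (heat_step \<epsilon> f) x \<le> (1 - \<epsilon> * \<kappa> + 4 * \<epsilon>\<^sup>2 * (real d)\<^sup>2) * M"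
proof -
  define X where "X = (\<Sum>y\<in>N x. (f y - f x) * (Lap f y - Lap f x))"
  have "Gam (heat_step \<epsilon> f) x = (\<Sum>y\<in>N x. (f y - f x)\<^sup>2
      + 2 * \<epsilon> * ((f y - f x) * (Lap f y - Lap f x)) + \<epsilon>\<^sup>2 * (Lap f y - Lap f x)\<^sup>2)"
    unfolding Gam_def heat_step_def
    by (intro sum.cong refl) (simp add: power2_eq_square algebra_simps)
  also have "\<dots> = Gam f x + 2 * \<epsilon> * X + \<epsilon>\<^sup>2 * Gam (Lap f) x"
    by (simp add: Gam_def X_def sum.distrib sum_distrib_left)
  finally have G: "Gam (heat_step \<epsilon> f) x = Gam f x + \<epsilon> * (2 * X) + \<epsilon>\<^sup>2 * Gam (Lap f) x" by simp
  \<comment> \<open>The factor 4 comes from (a - b)^2 \<le> 2 a^2 + 2 b^2, with both squares at most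
    \<open>d * M\<close>.\<close>
  have "Gam (Lap f) x \<le> (\<Sum>y\<in>N x. 4 * d * M)"
    unfolding Gam_def
  proof (rule sum_mono)
    fix y assume "y \<in> N x"
    then have "(Lap f y)\<^sup>2 \<le> d * M" "(Lap f x)\<^sup>2 \<le> d * M"
      using x nbr_in M by (auto intro!: order.trans[OF Lap_square_le] mult_left_mono)
    moreover have "0 \<le> (Lap f y + Lap f x)\<^sup>2" by simp
    ultimately show "(Lap f y - Lap f x)\<^sup>2 \<le> 4 * d * M"
      by (simp add: power2_eq_square algebra_simps)
  qed
  then have L: "Gam (Lap f) x \<le> 4 * (real d)\<^sup>2 * M"
    using x by (simp add: card_nbr power2_eq_square)
  have "Lap (Gam f) x \<le> (\<Sum>y\<in>N x. M - Gam f x)"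
    unfolding Lap_def using M nbr_in by (intro sum_mono) auto
  then have "2 * X \<le> d * (M - Gam f x) - \<kappa> * Gam f x"
    using curv x by (simp add: Gam2_def X_def[symmetric] card_nbr)
  then have "\<epsilon> * (2 * X) \<le> \<epsilon> * (d * (M - Gam f x) - \<kappa> * Gam f x)"
    using e by (intro mult_left_mono)
  moreover have "\<epsilon>\<^sup>2 * Gam (Lap f) x \<le> \<epsilon>\<^sup>2 * (4 * (real d)\<^sup>2 * M)"
    using L by (intro mult_left_mono) auto
  moreover have "(1 - \<epsilon> * (d + \<kappa>)) * Gam f x \<le> (1 - \<epsilon> * (d + \<kappa>)) * M"
    using e M[OF x] by (intro mult_left_mono) auto
  ultimately show ?thesis unfolding G by (simp add: algebra_simps)
qed

lemma Gam_heat_iterate: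
  fixes \<kappa> \<epsilon> M :: real
  assumes curv: "\<And>f x. x \<in> V \<Longrightarrow> Gam2 f x \<ge> \<kappa> * Gam f x"
    and M: "\<And>y. y \<in> V \<Longrightarrow> Gam f y \<le> M"
    and e: "0 \<le> \<epsilon>" "\<epsilon> * (d + \<kappa>) \<le> 1" and x: "x \<in> V"
  shows "Gam ((heat_step \<epsilon> ^^ n) f) x \<le> (1 - \<epsilon> * \<kappa> + 4 * \<epsilon>\<^sup>2 * (real d)\<^sup>2) ^ n * M"
  using x
proof (induction n arbitrary: x)
  case 0
  then show ?case using M by simp
next
  case (Suc n)
  then show ?case
    using Gam_heat_step[OF curv[OF Suc.prems] Suc.prems Suc.IH e] by (simp add: mult.assoc)
qed

text \<open>By \<open>Lap_square_le\<close>, step n moves the value by at most \<epsilon> d r^n;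
  these displacements form a geometric series.\<close>

lemma heat_iterate_diff:
  fixes r \<epsilon> :: real
  assumes "x \<in> V" and r: "0 \<le> r" "r < 1" and e: "0 \<le> \<epsilon>"
    and G: "\<And>n. Gam ((heat_step \<epsilon> ^^ n) f) x \<le> d * (r ^ n)\<^sup>2"
  shows "\<bar>(heat_step \<epsilon> ^^ n) f x - f x\<bar> \<le> \<epsilon> * d / (1 - r)"
proof -
  have "\<bar>(heat_step \<epsilon> ^^ n) f x - f x\<bar> \<le> \<epsilon> * d * (\<Sum>i<n. r ^ i)"
  proof (induction n)
    case (Suc n)
    let ?g = "(heat_step \<epsilon> ^^ n) f"
    have "(Lap ?g x)\<^sup>2 \<le> d * Gam ?g x" using assms by (intro Lap_square_le)
    also have "\<dots> \<le> d * (d * (r ^ n)\<^sup>2)" by (intro mult_left_mono G) simp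
    also have "\<dots> = (d * r ^ n)\<^sup>2" by (simp add: power2_eq_square algebra_simps)
    finally have "\<bar>Lap ?g x\<bar> \<le> d * r ^ n"
      using r by (simp add: abs_le_square_iff[symmetric])
    then have "\<epsilon> * \<bar>Lap ?g x\<bar> \<le> \<epsilon> * (d * r ^ n)" using e by (rule mult_left_mono)
    moreover have "\<bar>\<epsilon> * Lap ?g x\<bar> = \<epsilon> * \<bar>Lap ?g x\<bar>" using e by (simp add: abs_mult)
    moreover have "(heat_step \<epsilon> ^^ Suc n) f x - f x = (?g x - f x) + \<epsilon> * Lap ?g x"
      by (simp add: heat_step_def)
    ultimately show ?case using Suc by (simp add: algebra_simps)
  qed simp
  also have "(\<Sum>i<n. r ^ i) \<le> 1 / (1 - r)"
    using r by (subst sum_gp_strict) (auto simp: divide_right_mono)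
  then have "\<epsilon> * d * (\<Sum>i<n. r ^ i) \<le> \<epsilon> * d * (1 / (1 - r))"
    using e by (intro mult_left_mono) auto
  finally show ?thesis by simp
qed

text \<open>The length of a walk from \<open>u\<close> to \<open>v\<close> serves as
  \<open>C\<close>. Since it does not depend on \<open>f\<close>, one constant works for all heat
  iterates.\<close>

lemma reachable_diff_le:
  assumes uv: "(u, v) \<in> {(x, y). y \<in> N x}\<^sup>*" and u: "u \<in> V"
  shows "\<exists>C. \<forall>f G. (\<forall>x\<in>V. Gam f x \<le> G\<^sup>2) \<longrightarrow> 0 \<le> G \<longrightarrow> \<bar>f v - f u\<bar> \<le> C * G"
  using uv
proof induction
  case base
  show ?case by (rule exI[of _ 0]) simp
next
  case (step y w)
  then obtain C where C: "\<forall>f G. (\<forall>x\<in>V. Gam f x \<le> G\<^sup>2) \<longrightarrow> 0 \<le> G \<longrightarrow> \<bar>f y - f u\<bar> \<le> C * G"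
    by blast
  have w: "w \<in> N y" and y: "y \<in> V" using step nbr_in nbr_sym by blast+
  have "\<bar>f w - f u\<bar> \<le> (C + 1) * G" if G: "\<forall>x\<in>V. Gam f x \<le> G\<^sup>2" "0 \<le> G" for f G
  proof -
    have "(f w - f y)\<^sup>2 \<le> G\<^sup>2" using diff_square_le_Gam[OF y w, of f] G(1) y by force
    then have "\<bar>f w - f y\<bar> \<le> G" using G(2) by (simp add: abs_le_square_iff[symmetric])
    moreover have "\<bar>f y - f u\<bar> \<le> C * G" using C G by blast
    ultimately show ?thesis by (simp add: algebra_simps)
  qed
  then show ?case by blast
qed

text \<open>Discrete Bonnet--Myers: the explicit heat iteration contracts gradients geometrically, so
  it moves no value of \<open>f\<close> by more than a bounded amount, while it flattens \<open>f\<close> to a constant.\<close>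

lemma lipschitz_bounded:
  assumes d: "d > 0" and curv: "\<And>f x. x \<in> V \<Longrightarrow> Gam2 f x \<ge> 1 / d * Gam f x"
    and f: "\<And>x. x \<in> V \<Longrightarrow> Gam f x \<le> d"
    and u: "u \<in> V" and uv: "(u, v) \<in> {(x, y). y \<in> N x}\<^sup>*"
  shows "\<bar>f v - f u\<bar> \<le> 1 / (4 * (real d)\<^sup>2 * (1 - sqrt (1 - 1 / (16 * real d ^ 4))))"
proof -
  \<comment> \<open>This step minimises the contraction factor \<open>1 - \<epsilon> / d + 4 * \<epsilon>\<^sup>2 * d\<^sup>2\<close>.\<close>
  define \<epsilon> where "\<epsilon> = 1 / (8 * real d ^ 3)"
  \<comment> \<open>\<open>r\<close> is the square root of the contraction factor at this step size:
    the bound on \<open>Gam\<close> shrinks by r^2 per step, that on differences along edges by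
    r.\<close>
  define r where "r = sqrt (1 - 1 / (16 * real d ^ 4))"
  have D: "real d \<ge> 1" using d by simp
  have D4: "real d ^ 4 \<ge> 1" using D by (rule one_le_power)
  have e0: "0 \<le> \<epsilon>" by (simp add: \<epsilon>_def)
  have "16 * real d ^ 4 \<ge> 1" using D4 by linarith
  then have rho: "0 < 1 / (16 * real d ^ 4)" "1 / (16 * real d ^ 4) \<le> 1"
    using d by (simp_all add: divide_le_eq_1)
  then have r: "0 \<le> r" "r < 1" by (simp_all add: r_def)
  have r2: "1 - \<epsilon> * (1 / d) + 4 * \<epsilon>\<^sup>2 * (real d)\<^sup>2 = r\<^sup>2"
    using d rho by (simp add: r_def \<epsilon>_def field_simps power2_eq_square eval_nat_numeral)
  have "real d * real d + 1 \<le> 8 * real d ^ 4"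
  proof -
    have "real d ^ 2 \<le> real d ^ 4" using D by (intro power_increasing) auto
    then show ?thesis using D4 by (simp add: power2_eq_square)
  qed
  then have e1: "\<epsilon> * (d + 1 / d) \<le> 1"
    using d by (simp add: \<epsilon>_def field_simps eval_nat_numeral)
  define F where "F n = (heat_step \<epsilon> ^^ n) f" for n
  have G: "Gam (F n) x \<le> d * (r ^ n)\<^sup>2" if "x \<in> V" for n x
    using Gam_heat_iterate[OF curv f e0 e1 that, of n] unfolding r2 F_def
    by (simp add: power_mult[symmetric] mult.commute)
  have v: "v \<in> V" using uv u by (induction) (use nbr_in in auto)
  have near: "\<bar>F n x - f x\<bar> \<le> \<epsilon> * d / (1 - r)" if "x \<in> V" for x n
    unfolding F_def using that r e0 G by (intro heat_iterate_diff) (auto simp: F_def)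
  obtain C where C: "\<And>f G. \<lbrakk>\<forall>x\<in>V. Gam f x \<le> G\<^sup>2; 0 \<le> G\<rbrakk> \<Longrightarrow> \<bar>f v - f u\<bar> \<le> C * G"
    using reachable_diff_le[OF uv u] by blast
  have flat: "\<bar>F n v - F n u\<bar> \<le> C * (sqrt d * r ^ n)" for n
    using G r by (intro C) (auto simp: power_mult_distrib)
  \<comment> \<open>The difference of \<open>f\<close> is at most the displacements at
    \<open>u\<close> and \<open>v\<close> plus the difference of the n-th iterate, whose bound tends
    to 0.\<close>
  have "(\<lambda>n. 2 * (\<epsilon> * d / (1 - r)) + C * (sqrt d * r ^ n)) \<longlonglongrightarrow> 2 * (\<epsilon> * d / (1 - r)) + C * (sqrt d * 0)"
    using r by (intro tendsto_intros LIMSEQ_power_zero) auto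
  moreover have "\<bar>f v - f u\<bar> \<le> 2 * (\<epsilon> * d / (1 - r)) + C * (sqrt d * r ^ n)" for n
    using near[OF u, of n] near[OF v, of n] flat[of n] by linarith
  ultimately have "\<bar>f v - f u\<bar> \<le> 2 * (\<epsilon> * d / (1 - r))"
    using LIMSEQ_le_const[of _ _ "\<bar>f v - f u\<bar>"] by fastforce
  also have "\<epsilon> * d = 1 / (8 * (real d)\<^sup>2)"
    using d by (simp add: \<epsilon>_def field_simps power2_eq_square eval_nat_numeral)
  also have "2 * (1 / (8 * (real d)\<^sup>2) / (1 - r)) = 1 / (4 * (real d)\<^sup>2 * (1 - r))"
    by simp
  finally show ?thesis by (simp add: r_def)
qed

section \<open>Walks, diameter and order\<close>

abbreviation edges :: "'a rel" where
  "edges \<equiv> {(x, y). y \<in> N x}"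

lemma walk_end_in: "(u, v) \<in> edges ^^ k \<Longrightarrow> u \<in> V \<Longrightarrow> v \<in> V"
  by (cases k) (auto dest: nbr_in)

lemma card_walk_ends:
  assumes "u \<in> V"
  shows "finite ((edges ^^ k) `` {u}) \<and> card ((edges ^^ k) `` {u}) \<le> d ^ k"
proof (induction k)
  case (Suc k)
  let ?S = "(edges ^^ k) `` {u}"
  have S: "?S \<subseteq> V" using walk_end_in assms by blast
  have eq: "(edges ^^ Suc k) `` {u} = (\<Union>y\<in>?S. N y)" by auto
  have "card (\<Union>y\<in>?S. N y) \<le> (\<Sum>y\<in>?S. card (N y))" using Suc by (intro card_UN_le) simp
  also have "\<dots> = card ?S * d" using S by (simp add: card_nbr subset_iff)
  also have "\<dots> \<le> d ^ k * d" using Suc by (intro mult_right_mono) auto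
  finally have "card (\<Union>y\<in>?S. N y) \<le> d ^ Suc k" by (simp add: mult.commute)
  moreover have "finite (\<Union>y\<in>?S. N y)" using Suc S finite_nbr by blast
  ultimately show ?case unfolding eq by blast
qed simp

text \<open>The choice \<kappa> = 1 / d is admissible at every vertex: the curvature expression is a
  positive integer, hence at least 1, and \<beta> \<le> d because the common neighbours of
  \<open>y\<close> and \<open>z\<close> lie in \<open>N y\<close>, so \<beta> \<kappa> \<le>
  1.\<close>

lemma curvature_if_geodesic3:
  assumes z: "z \<in> V" and x: "x \<in> N z" and y: "y \<in> N x" and v: "v \<in> N y"
    and yz: "y \<noteq> z" "y \<notin> N z" and vz: "v \<notin> N z" "N z \<inter> N v = {}"
    and ab: "int \<alpha> \<le> 6 * int \<beta> - 9"
  shows "d > 0" "w \<in> V \<Longrightarrow> Gam2 f w \<ge> 1 / d * Gam f w"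
proof -
  have V: "y \<in> V" using y nbr_in by blast
  have "x \<in> N y \<inter> N z" using x y nbr_sym by blast
  then have "card (N y \<inter> N z) = \<beta>" using V z yz nbr_sym[of z y] by (intro card_dist2) auto
  moreover have "card (N y \<inter> N z) \<le> card (N y)" using V finite_nbr by (intro card_mono) auto
  ultimately have bd: "\<beta> \<le> d" using V card_nbr by simp
  have b: "\<beta> > 0" using ab by simp
  then show d: "d > 0" using bd by simp
  have "1 \<le> 2 * int d * (int \<beta> - 2) + (int \<alpha> + 4) * int \<beta> - (int \<alpha>)\<^sup>2"
    using assms by (rule geodesic3_curvature)
  then have "real_of_int 1 \<le> real_of_int (2 * int d * (int \<beta> - 2) + (int \<alpha> + 4) * int \<beta> - (int \<alpha>)\<^sup>2)"
    by (simp only: of_int_le_iff)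
  moreover have "\<beta> * (1 / real d) \<le> 1" using bd d by (simp add: divide_le_eq_1)
  ultimately have "\<beta> * (1 / real d) \<le> 2 * d * (real \<beta> - 2) + (\<alpha> + 4) * \<beta> - (real \<alpha>)\<^sup>2"
    by simp
  moreover have "1 / real d \<le> 1" using d by simp
  then have "1 / real d \<le> \<alpha> + 4" by linarith
  ultimately show "Gam2 f w \<ge> 1 / d * Gam f w" if "w \<in> V"
    using that b d by (intro Gam2_ge)
qed

text \<open>The distance from \<open>u\<close> changes by at most 1 along an edge, so its
  \<open>Gam\<close> is at most \<open>d\<close> and \<open>lipschitz_bounded\<close> applies. One
  vertex at distance at least 3 supplies the geodesic that makes the curvature positive
  everywhere.\<close>

lemma short_walk:
  assumes u: "u \<in> V" and v: "v \<in> V" and conn: "\<And>v. v \<in> V \<Longrightarrow> (u, v) \<in> edges\<^sup>*"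
    and ab: "int \<alpha> \<le> 6 * int \<beta> - 9"
  shows "\<exists>k\<le>diameter_bound d. (u, v) \<in> edges ^^ k"
proof -
  define dst where "dst w = (LEAST k. (u, w) \<in> edges ^^ k)" for w
  have walk: "(u, w) \<in> edges ^^ dst w" if "w \<in> V" for w
    using rtrancl_imp_relpow[OF conn[OF that]] unfolding dst_def by (metis LeastI_ex)
  have least: "dst w \<le> k" if "(u, w) \<in> edges ^^ k" for w k
    unfolding dst_def using that by (rule Least_le)
  have "dst v \<le> diameter_bound d"
  proof (cases "dst v \<le> 2")
    case False
    then obtain m where m: "dst v = 3 + m" using le_Suc_ex[of 3 "dst v"] by auto
    \<comment> \<open>\<open>p\<close> is reached after three steps of a shortest walk to
      \<open>v\<close>; a shorter walk to \<open>p\<close> would shorten the one to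
      \<open>v\<close>.\<close>
    then obtain p where p: "(u, p) \<in> edges ^^ 3" "(p, v) \<in> edges ^^ m"
      using walk[OF v] by (auto simp: relpow_add)
    have far: "(u, p) \<notin> edges ^^ k" if "k < 3" for k
    proof
      assume "(u, p) \<in> edges ^^ k"
      then have "(u, v) \<in> edges ^^ (k + m)" using p by (auto simp: relpow_add)
      then show False using least m that by fastforce
    qed
    obtain x y where xy: "x \<in> N u" "y \<in> N x" "p \<in> N y"
      using p(1) by (auto simp: eval_nat_numeral)
    have f0: "p \<noteq> u" and f1: "p \<notin> N u" and f2: "\<And>q. q \<in> N u \<Longrightarrow> p \<notin> N q"
      using far[of 0] far[of 1] far[of 2] by (auto simp: eval_nat_numeral)
    have geo: "y \<noteq> u" "y \<notin> N u" "N u \<inter> N p = {}"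
      using f1 f2 xy nbr_sym by blast+
    note curv = curvature_if_geodesic3[OF u xy geo(1,2) f1 geo(3) ab]
    define f where "f w = real (dst w)" for w
    have step: "dst y \<le> dst x + 1" if "x \<in> V" "y \<in> N x" for x y
      using walk[OF that(1)] that(2) by (intro least) auto
    have grad: "Gam f x \<le> d" if x: "x \<in> V" for x
    proof -
      have "Gam f x \<le> (\<Sum>y\<in>N x. 1)"
        unfolding Gam_def
      proof (rule sum_mono)
        fix y assume y: "y \<in> N x"
        then have "\<bar>f y - f x\<bar> \<le> 1"
          using step[OF x y] step[OF nbr_in[OF y] nbr_sym[OF y]] by (simp add: f_def)
        then show "(f y - f x)\<^sup>2 \<le> 1" by (simp add: abs_square_le_1)
      qed
      then show ?thesis using x by (simp add: card_nbr)
    qed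
    have "\<bar>f v - f u\<bar> \<le> 1 / (4 * (real d)\<^sup>2 * (1 - sqrt (1 - 1 / (16 * real d ^ 4))))"
      using curv grad u conn[OF v] by (rule lipschitz_bounded)
    moreover have "f u = 0" using least[of u 0] by (simp add: f_def)
    ultimately have "real (dst v) \<le> 1 / (4 * (real d)\<^sup>2 * (1 - sqrt (1 - 1 / (16 * real d ^ 4))))"
      by (simp add: f_def)
    then show ?thesis unfolding diameter_bound_def by (intro max.coboundedI2 le_nat_floor)
  qed (simp add: diameter_bound_def)
  then show ?thesis using walk[OF v] by blast
qed

lemma order_le:
  assumes u: "u \<in> V" and conn: "\<And>v. v \<in> V \<Longrightarrow> (u, v) \<in> edges\<^sup>*"
    and ab: "int \<alpha> \<le> 6 * int \<beta> - 9"
  shows "finite V \<and> card V \<le> order_bound d"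
proof -
  let ?B = "\<Union>k\<le>diameter_bound d. (edges ^^ k) `` {u}"
  have "V \<subseteq> ?B" using short_walk[OF u _ conn ab] by blast
  moreover have "finite ?B" using card_walk_ends[OF u] by blast
  moreover have "card ?B \<le> (\<Sum>k\<le>diameter_bound d. card ((edges ^^ k) `` {u}))"
    by (rule card_UN_le) simp
  moreover have "\<dots> \<le> order_bound d"
    unfolding order_bound_def using card_walk_ends[OF u] by (intro sum_mono) blast
  ultimately show ?thesis
    using finite_subset[of V ?B] card_mono[of ?B V] by linarith
qed

end

section \<open>Graphs and their isomorphism types\<close>

definition neighbors :: "'a pair_pre_digraph \<Rightarrow> 'a \<Rightarrow> 'a set" where
  "neighbors G x = {y. (x, y) \<in> parcs G}"

text \<open>\<open>graph_dist\<close> is an infimum of walk lengths. These are integers, so without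
  walks of length 0, 1 and 2 it is at least 3, also when there is no walk and it is
  infinite.\<close>

lemma graph_dist_eq_2_iff:
  assumes "pair_wf_digraph G" and u: "u \<in> pverts G"
  shows "graph_dist G u v = 2 \<longleftrightarrow> u \<noteq> v \<and> v \<notin> neighbors G u \<and> (\<exists>w\<in>neighbors G u. v \<in> neighbors G w)"
proof -
  interpret pair_wf_digraph G by fact
  have cost: "awalk_cost (\<lambda>_. 1) p = real (length p)" for p
    by (induction p) auto
  have dist: "graph_dist G u v = (INF p\<in>{p. awalk u p v}. ereal (length p))"
    by (simp add: graph_dist_def \<mu>_def cost)
  have upper: "graph_dist G u v \<le> ereal (length p)" if "awalk u p v" for p
    unfolding dist using that by (auto intro: INF_lower)
  have lower: "ereal c \<le> graph_dist G u v" if "\<And>p. awalk u p v \<Longrightarrow> c \<le> real (length p)" for c :: real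
    unfolding dist using that by (auto intro!: INF_greatest)
  have walk0: "awalk u [] v \<longleftrightarrow> u = v" using u by (auto simp: awalk_Nil_iff)
  have walk1: "awalk u [e] v \<longleftrightarrow> e = (u, v) \<and> v \<in> neighbors G u" for e
    by (cases e) (auto simp: awalk_Cons_iff awalk_Nil_iff neighbors_def dest: in_arcsD2)
  have walk2: "awalk u [e, e'] v \<longleftrightarrow> (\<exists>w\<in>neighbors G u. v \<in> neighbors G w \<and> e = (u, w) \<and> e' = (w, v))" for e e'
    by (cases e; cases e') (auto simp: awalk_Cons_iff awalk_Nil_iff neighbors_def dest: in_arcsD2)
  show ?thesis (is "_ \<longleftrightarrow> ?R")
  proof
    assume two: "graph_dist G u v = 2"
    have "u \<noteq> v" using upper[of "[]"] walk0 two by auto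
    moreover have "v \<notin> neighbors G u" using upper[of "[(u, v)]"] walk1 two by auto
    moreover have "\<exists>w\<in>neighbors G u. v \<in> neighbors G w"
    proof (rule ccontr)
      assume none: "\<not> (\<exists>w\<in>neighbors G u. v \<in> neighbors G w)"
      have "ereal 3 \<le> graph_dist G u v"
      proof (rule lower)
        fix p assume "awalk u p v"
        then have "length p \<noteq> 0" "length p \<noteq> 1" "length p \<noteq> 2"
          using calculation walk0 walk1 walk2 none by (auto simp: length_Suc_conv eval_nat_numeral)
        then show "3 \<le> real (length p)" by linarith
      qed
      then show False using two by simp
    qed
    ultimately show ?R by blast
  next
    assume R: ?R
    then obtain w where w: "w \<in> neighbors G u" "v \<in> neighbors G w" by blast
    have "graph_dist G u v \<le> 2" using upper[of "[(u, w), (w, v)]"] walk2 w by auto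
    moreover have "ereal 2 \<le> graph_dist G u v"
    proof (rule lower)
      fix p assume "awalk u p v"
      then have "length p \<noteq> 0" "length p \<noteq> 1"
        using R walk0 walk1 by (auto simp: length_Suc_conv)
      then show "2 \<le> real (length p)" by linarith
    qed
    ultimately show "graph_dist G u v = 2" by simp
  qed
qed

lemma pair_bidirected_iff:
  "pair_bidirected_digraph G \<longleftrightarrow> (\<forall>u v. (u, v) \<in> parcs G \<longrightarrow> u \<in> pverts G \<and> v \<in> pverts G \<and> u \<noteq> v \<and> (v, u) \<in> parcs G)"
  unfolding pair_bidirected_digraph_def pair_sym_digraph_def pair_loopfree_digraph_def
    pair_sym_digraph_axioms_def pair_loopfree_digraph_axioms_def pair_wf_digraph_def symmetric_def sym_def
  by fastforce

text \<open>Bidirectedness supplies symmetry, irreflexivity and containment; the other axioms of the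
  locale match the clauses of \<open>amply_regular\<close> through
  \<open>graph_dist_eq_2_iff\<close>.\<close>

lemma amply_regular_iff_nbhd:
  "amply_regular G n d \<alpha> \<beta> \<longleftrightarrow> pair_bidirected_digraph G \<and> graph_order G = n
     \<and> amply_regular_nbhd (pverts G) (neighbors G) d \<alpha> \<beta>"
proof (cases "pair_bidirected_digraph G")
  case True
  interpret pair_bidirected_digraph G by fact
  have wf: "pair_wf_digraph G" by unfold_locales
  have arc: "u \<in> pverts G" "v \<in> pverts G" "u \<noteq> v" "u \<in> neighbors G v" if "v \<in> neighbors G u" for u v
    using that True by (auto simp: pair_bidirected_iff neighbors_def)
  have "out_arcs (with_proj G) v = Pair v ` neighbors G v" for v
    by (auto simp: out_arcs_def neighbors_def)
  then have reg: "regular_graph G d \<longleftrightarrow> (\<forall>v\<in>pverts G. finite (neighbors G v) \<and> card (neighbors G v) = d)"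
    by (simp add: regular_graph_def out_degree_def finite_image_iff card_image inj_on_def)
  have com: "common_neighbors G u v = neighbors G u \<inter> neighbors G v" for u v
    using arc by (auto simp: common_neighbors_def neighbors_def)
  have adj: "(u, v) \<in> parcs G \<longleftrightarrow> v \<in> neighbors G u" for u v by (simp add: neighbors_def)
  have dist2: "graph_dist G u v = 2 \<longleftrightarrow> u \<noteq> v \<and> v \<notin> neighbors G u \<and> neighbors G u \<inter> neighbors G v \<noteq> {}"
    if "u \<in> pverts G" for u v
    using graph_dist_eq_2_iff[OF wf that] arc by blast
  have "amply_regular G n d \<alpha> \<beta> \<longleftrightarrow> graph_order G = n
      \<and> (\<forall>v\<in>pverts G. finite (neighbors G v) \<and> card (neighbors G v) = d)
      \<and> (\<forall>u v. v \<in> neighbors G u \<longrightarrow> card (neighbors G u \<inter> neighbors G v) = \<alpha>)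
      \<and> (\<forall>u\<in>pverts G. \<forall>v\<in>pverts G. u \<noteq> v \<and> v \<notin> neighbors G u \<and> neighbors G u \<inter> neighbors G v \<noteq> {}
            \<longrightarrow> card (neighbors G u \<inter> neighbors G v) = \<beta>)"
    unfolding amply_regular_def reg com adj using True by (simp only: dist2 simp_thms cong: ball_cong)
  also have "\<dots> \<longleftrightarrow> graph_order G = n \<and> amply_regular_nbhd (pverts G) (neighbors G) d \<alpha> \<beta>"
  proof -
    have ax: "(\<forall>y x. y \<in> neighbors G x \<longrightarrow> x \<in> neighbors G y) = True"
      "(\<forall>x. x \<notin> neighbors G x) = True"
      "(\<forall>y x. y \<in> neighbors G x \<longrightarrow> y \<in> pverts G) = True"
      using arc by blast+
    show ?thesis unfolding amply_regular_nbhd_def ax simp_thms by blast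
  qed
  finally show ?thesis using True by simp
qed (simp add: amply_regular_def)

text \<open>Connectedness refers to the symmetric closure; as the arcs are already symmetric, it
  yields directed walks.\<close>

lemma connected_rtrancl:
  assumes "pair_bidirected_digraph G" "connected (with_proj G)" "u \<in> pverts G" "v \<in> pverts G"
  shows "(u, v) \<in> {(x, y). y \<in> neighbors G x}\<^sup>*"
proof -
  interpret pair_bidirected_digraph G by fact
  have "strongly_connected (with_proj G)"
    using assms(2) sym_arcs by (intro symmetric_connected_imp_strongly_connected)
  then have "u \<rightarrow>\<^sup>*\<^bsub>with_proj G\<^esub> v" using assms by (auto simp: strongly_connected_def)
  then show ?thesis using reachable_rtranclI by (fastforce simp: neighbors_def)
qed

lemma amply_regular_order_le:
  assumes "connected (with_proj G)" and G: "amply_regular G n d \<alpha> \<beta>"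
    and ab: "int \<alpha> \<le> 6 * int \<beta> - 9"
  shows "finite (pverts G) \<and> card (pverts G) \<le> order_bound d"
proof -
  have bi: "pair_bidirected_digraph G" and nb: "amply_regular_nbhd (pverts G) (neighbors G) d \<alpha> \<beta>"
    using G by (auto simp: amply_regular_iff_nbhd)
  interpret pair_bidirected_digraph G by fact
  obtain u where u: "u \<in> pverts G" using assms(1) by (auto simp: connected_def strongly_connected_def)
  show ?thesis
    using amply_regular_nbhd.order_le[OF nb u connected_rtrancl[OF bi assms(1) u] ab] .
qed

section \<open>Relabelling the vertices\<close>

definition relabel :: "('a \<Rightarrow> 'b) \<Rightarrow> 'a pair_pre_digraph \<Rightarrow> 'b pair_pre_digraph" where
  "relabel h G = \<lparr>pverts = h ` pverts G, parcs = map_prod h h ` parcs G\<rparr>"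

lemma parcs_relabel: "(u, v) \<in> parcs (relabel h G) \<longleftrightarrow> (\<exists>a b. (a, b) \<in> parcs G \<and> u = h a \<and> v = h b)"
  by (auto simp: relabel_def)

lemma neighbors_relabel:
  assumes "pair_bidirected_digraph G" and inj: "inj_on h (pverts G)" and x: "x \<in> pverts G"
  shows "neighbors (relabel h G) (h x) = h ` neighbors G x"
proof -
  have "a = x" if "(a, b) \<in> parcs G" "h x = h a" for a b
    using that assms by (auto simp: pair_bidirected_iff dest: inj_onD)
  then show ?thesis by (auto simp: neighbors_def parcs_relabel)
qed

lemma pair_bidirected_relabel:
  assumes G: "pair_bidirected_digraph G" and inj: "inj_on h (pverts G)"
  shows "pair_bidirected_digraph (relabel h G)"
  unfolding pair_bidirected_iff
proof (intro allI impI)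
  fix u v assume "(u, v) \<in> parcs (relabel h G)"
  then obtain a b where ab: "(a, b) \<in> parcs G" "u = h a" "v = h b" by (auto simp: parcs_relabel)
  then have "a \<in> pverts G" "b \<in> pverts G" "a \<noteq> b" "(b, a) \<in> parcs G"
    using G by (auto simp: pair_bidirected_iff)
  moreover from this have "h a \<noteq> h b" using inj by (auto dest: inj_onD)
  ultimately show "u \<in> pverts (relabel h G) \<and> v \<in> pverts (relabel h G) \<and> u \<noteq> v \<and> (v, u) \<in> parcs (relabel h G)"
    using ab by (auto simp: parcs_relabel) (auto simp: relabel_def)
qed

text \<open>On \<open>V\<close> the map \<open>h\<close> preserves cardinalities and commutes with
  intersections, so each axiom pulls back to \<open>V\<close>; \<open>out\<close> ensures that
  whatever has a neighbour has a preimage.\<close>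

lemma amply_regular_nbhd_image:
  assumes "amply_regular_nbhd V N d \<alpha> \<beta>" and inj: "inj_on h V"
    and N': "\<And>x. x \<in> V \<Longrightarrow> N' (h x) = h ` N x" and out: "\<And>y. y \<notin> h ` V \<Longrightarrow> N' y = {}"
  shows "amply_regular_nbhd (h ` V) N' d \<alpha> \<beta>"
proof -
  interpret amply_regular_nbhd V N d \<alpha> \<beta> by fact
  have NV: "N x \<subseteq> V" for x using nbr_in by blast
  have mem: "h y \<in> N' (h x) \<longleftrightarrow> y \<in> N x" if "x \<in> V" "y \<in> V" for x y
    using that N' inj NV by (auto simp: inj_on_image_mem_iff)
  have int: "N' (h x) \<inter> N' (h y) = h ` (N x \<inter> N y)" if "x \<in> V" "y \<in> V" for x y
    using that N' inj NV by (simp add: inj_on_image_Int)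
  have card_h: "card (h ` S) = card S" if "S \<subseteq> V" for S
    using inj that by (meson card_image inj_on_subset)
  have dom: "\<exists>a\<in>V. \<exists>b\<in>V. x = h a \<and> y = h b \<and> b \<in> N a" if "y \<in> N' x" for x y
  proof -
    have "x \<in> h ` V" using that out by blast
    then obtain a where "a \<in> V" "x = h a" by blast
    then show ?thesis using that N' NV by blast
  qed
  show ?thesis
  proof
    show "x \<in> N' y" if "y \<in> N' x" for x y using dom[OF that] nbr_sym mem by blast
    show "x \<notin> N' x" for x
    proof
      assume "x \<in> N' x"
      then obtain a b where "a \<in> V" "b \<in> V" "x = h a" "x = h b" "b \<in> N a" using dom by blast
      then show False using inj nbr_irrefl by (metis inj_onD)
    qed
    show "y \<in> h ` V" if "y \<in> N' x" for x y using dom[OF that] by blast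
    show "finite (N' x)" "card (N' x) = d" if "x \<in> h ` V" for x
      using that N' finite_nbr card_nbr card_h NV by auto
    show "card (N' x \<inter> N' y) = \<alpha>" if "y \<in> N' x" for x y
      using dom[OF that] int card_adjacent card_h NV by (metis inf.coboundedI1)
    show "card (N' x \<inter> N' y) = \<beta>"
      if xy: "x \<in> h ` V" "y \<in> h ` V" "x \<noteq> y" "y \<notin> N' x" "N' x \<inter> N' y \<noteq> {}" for x y
    proof -
      obtain a b where ab: "a \<in> V" "b \<in> V" "x = h a" "y = h b" using xy by blast
      then have "card (N a \<inter> N b) = \<beta>" using xy int mem by (intro card_dist2) auto
      then show ?thesis using int ab card_h NV by (metis inf.coboundedI1)
    qed
  qed
qed

lemma amply_regular_relabel:
  assumes G: "amply_regular G n d \<alpha> \<beta>" and inj: "inj_on h (pverts G)"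
  shows "amply_regular (relabel h G) n d \<alpha> \<beta>"
proof -
  have bi: "pair_bidirected_digraph G" and nb: "amply_regular_nbhd (pverts G) (neighbors G) d \<alpha> \<beta>"
    and n: "graph_order G = n"
    using G by (auto simp: amply_regular_iff_nbhd)
  have V: "pverts (relabel h G) = h ` pverts G" by (simp add: relabel_def)
  have "neighbors (relabel h G) y = {}" if "y \<notin> h ` pverts G" for y
    using that bi by (fastforce simp: neighbors_def relabel_def pair_bidirected_iff)
  then have "amply_regular_nbhd (h ` pverts G) (neighbors (relabel h G)) d \<alpha> \<beta>"
    using neighbors_relabel[OF bi inj] by (intro amply_regular_nbhd_image[OF nb inj])
  moreover have "graph_order (relabel h G) = n"
    using inj unfolding n[symmetric] by (simp add: graph_order_def V card_image finite_image_iff)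
  ultimately show ?thesis
    using pair_bidirected_relabel[OF bi inj] by (simp add: amply_regular_iff_nbhd V)
qed

text \<open>Arcs are pairs, so the isomorphism acts on them coordinatewise and tail and head remain
  the projections.\<close>

lemma relabel_isomorphism:
  assumes "pair_bidirected_digraph G" and inj: "inj_on h (pverts G)"
  defines "hom \<equiv> \<lparr>iso_verts = h, iso_arcs = map_prod h h, iso_head = snd, iso_tail = fst\<rparr>"
  shows "pre_digraph.digraph_isomorphism (with_proj G) hom" "with_proj (relabel h G) = app_iso hom (with_proj G)"
proof -
  interpret pair_bidirected_digraph G by fact
  have "parcs G \<subseteq> pverts G \<times> pverts G" using in_arcsD1 in_arcsD2 by auto
  then have "inj_on (map_prod h h) (parcs G)"
    using map_prod_inj_on[OF inj inj] inj_on_subset by blast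
  then show "pre_digraph.digraph_isomorphism (with_proj G) hom"
    using inj wf_digraph_wp_iff[of G] pair_wf_digraph_axioms
    by (simp add: pre_digraph.digraph_isomorphism_def hom_def)
  show "with_proj (relabel h G) = app_iso hom (with_proj G)"
    by (simp add: with_proj_def app_iso_def relabel_def hom_def)
qed

lemma digraph_iso_relabel:
  assumes "pair_bidirected_digraph G" "inj_on h (pverts G)"
  shows "digraph_iso (with_proj G) (with_proj (relabel h G))"
  using relabel_isomorphism[OF assms] unfolding digraph_iso_def by blast

lemma bounded_alpha_graphs_relabel:
  assumes G: "G \<in> bounded_alpha_graphs d" and inj: "inj_on h (pverts G)"
  shows "relabel h G \<in> bounded_alpha_graphs d"
proof -
  obtain n \<alpha> \<beta> where ar: "amply_regular G n d \<alpha> \<beta>" "int \<alpha> \<le> 6 * int \<beta> - 9"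
    and G': "connected (with_proj G)" "\<not> complete_graph G" "\<not> empty_graph G"
    using G by (auto simp: bounded_alpha_graphs_def)
  have bi: "pair_bidirected_digraph G" using ar by (simp add: amply_regular_def)
  interpret pair_bidirected_digraph G by fact
  have "connected (with_proj (relabel h G))"
    using connectedI_app_iso[OF G'(1)] relabel_isomorphism[OF bi inj] by simp
  moreover have "\<not> complete_graph (relabel h G)"
  proof
    assume c: "complete_graph (relabel h G)"
    have "(u, v) \<in> parcs G" if uv: "u \<in> pverts G" "v \<in> pverts G" "u \<noteq> v" for u v
    proof -
      have "h u \<noteq> h v" using uv inj by (auto dest: inj_onD)
      then have "(h u, h v) \<in> parcs (relabel h G)" using c uv by (simp add: complete_graph_def relabel_def)
      then have "h v \<in> h ` neighbors G u"
        using neighbors_relabel[OF bi inj uv(1)] by (auto simp: neighbors_def)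
      then show ?thesis using uv inj in_arcsD2 by (auto simp: neighbors_def dest: inj_onD)
    qed
    then show False using G'(2) by (auto simp: complete_graph_def)
  qed
  moreover have "\<not> empty_graph (relabel h G)" using G'(3) by (simp add: empty_graph_def relabel_def)
  ultimately show ?thesis
    using amply_regular_relabel[OF ar(1) inj] ar(2) unfolding bounded_alpha_graphs_def by blast
qed

text \<open>The bound on the order depends on \<open>d\<close> alone, so numbering the vertices
  places all these graphs on subsets of one fixed finite set.\<close>

lemma bounded_alpha_graphs_representative:
  assumes G: "G \<in> bounded_alpha_graphs d"
  obtains H :: "nat pair_pre_digraph" where "H \<in> bounded_alpha_graphs d"
    "pverts H \<subseteq> {..<order_bound d}" "digraph_iso (with_proj G) (with_proj H)"
proof -
  obtain n \<alpha> \<beta> where ar: "amply_regular G n d \<alpha> \<beta>" "int \<alpha> \<le> 6 * int \<beta> - 9" and "connected (with_proj G)"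
    using G by (auto simp: bounded_alpha_graphs_def)
  then have fin: "finite (pverts G)" and le: "card (pverts G) \<le> order_bound d"
    using amply_regular_order_le by blast+
  obtain h where h: "bij_betw h (pverts G) {0..<card (pverts G)}"
    using ex_bij_betw_finite_nat[OF fin] by blast
  then have inj: "inj_on h (pverts G)" by (rule bij_betw_imp_inj_on)
  have bi: "pair_bidirected_digraph G" using ar by (simp add: amply_regular_def)
  have "pverts (relabel h G) \<subseteq> {..<order_bound d}"
    using bij_betw_imp_surj_on[OF h] le by (auto simp: relabel_def)
  then show ?thesis
    using that bounded_alpha_graphs_relabel[OF G inj] digraph_iso_relabel[OF bi inj] by blast
qed

section \<open>Finiteness of the set of isomorphism types\<close>

lemma bounded_alpha_graphs_wf: "G \<in> bounded_alpha_graphs d \<Longrightarrow> pair_wf_digraph G"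
  by (auto simp: bounded_alpha_graphs_def amply_regular_def pair_bidirected_digraph_def pair_sym_digraph_def)

lemma finite_graphs_on:
  assumes "finite S"
  shows "finite {H. pair_wf_digraph H \<and> pverts H \<subseteq> S}"
proof (rule finite_subset)
  show "{H. pair_wf_digraph H \<and> pverts H \<subseteq> S}
      \<subseteq> (\<lambda>(V, E). \<lparr>pverts = V, parcs = E\<rparr>) ` (Pow S \<times> Pow (S \<times> S))"
  proof
    fix H :: "'a pair_pre_digraph"
    assume H: "H \<in> {H. pair_wf_digraph H \<and> pverts H \<subseteq> S}"
    then have "parcs H \<subseteq> S \<times> S" by (auto dest: pair_wf_digraph.in_arcsD1 pair_wf_digraph.in_arcsD2)
    then show "H \<in> (\<lambda>(V, E). \<lparr>pverts = V, parcs = E\<rparr>) ` (Pow S \<times> Pow (S \<times> S))"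
      using H by (intro image_eqI[where x = "(pverts H, parcs H)"]) auto
  qed
qed (use assms in simp)

text \<open>Both inclusions are transitivity; reversing the isomorphism is where well-formedness of
  \<open>G\<close> enters.\<close>

lemma graph_iso_class_eq:
  assumes wf: "wf_digraph (with_proj G)" and iso: "digraph_iso (with_proj G) (with_proj H)"
  shows "graph_iso_rel `` {G} = graph_iso_rel `` {H}"
  using digraph_iso_trans[OF iso] digraph_iso_trans[OF digraph_iso_swap[OF wf iso]]
  by (auto simp: graph_iso_rel_def)

text \<open>Isomorphism types are counted among graphs on the naturals; the last conjunct ensures
  that this misses none over another vertex type.\<close>

theorem theorem1p5:
  shows "(\<forall>(G :: 'a pair_pre_digraph) (n :: enat) (d :: nat) (\<alpha> :: nat) (\<beta> :: nat).
            connected (with_proj G) \<and> \<not> complete_graph G \<and> \<not> empty_graph G \<and>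
            amply_regular G n d \<alpha> \<beta> \<and> int \<alpha> \<le> 6 * int \<beta> - 9
            \<longrightarrow> finite (pverts G)) \<and>
         (\<forall>d :: nat.
            finite ((bounded_alpha_graphs d :: nat pair_pre_digraph set) // graph_iso_rel) \<and>
            (\<forall>G \<in> (bounded_alpha_graphs d :: 'a pair_pre_digraph set).
               \<exists>H \<in> (bounded_alpha_graphs d :: nat pair_pre_digraph set).
                 digraph_iso (with_proj G) (with_proj H)))"
proof (intro conjI allI impI ballI)
  fix G :: "'a pair_pre_digraph" and n d \<alpha> \<beta>
  assume "connected (with_proj G) \<and> \<not> complete_graph G \<and> \<not> empty_graph G \<and>
            amply_regular G n d \<alpha> \<beta> \<and> int \<alpha> \<le> 6 * int \<beta> - 9"
  then show "finite (pverts G)" using amply_regular_order_le by blast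
next
  fix d :: nat
  let ?A = "bounded_alpha_graphs d :: nat pair_pre_digraph set"
  let ?R = "{H :: nat pair_pre_digraph. pair_wf_digraph H \<and> pverts H \<subseteq> {..<order_bound d}}"
  \<comment> \<open>Every class is that of a graph with vertices below \<open>order_bound d\<close>,
    and there are finitely many such graphs.\<close>
  have "?A // graph_iso_rel \<subseteq> (\<lambda>H. graph_iso_rel `` {H}) ` ?R"
  proof
    fix C assume "C \<in> ?A // graph_iso_rel"
    then obtain G where G: "G \<in> ?A" and C: "C = graph_iso_rel `` {G}" by (rule quotientE)
    obtain H :: "nat pair_pre_digraph" where "H \<in> ?A" "pverts H \<subseteq> {..<order_bound d}"
      and iso: "digraph_iso (with_proj G) (with_proj H)"
      using bounded_alpha_graphs_representative[OF G] by blast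
    then have "H \<in> ?R" using bounded_alpha_graphs_wf by blast
    moreover have "C = graph_iso_rel `` {H}"
      unfolding C using bounded_alpha_graphs_wf[OF G] iso
      by (intro graph_iso_class_eq) (simp_all add: wf_digraph_wp_iff)
    ultimately show "C \<in> (\<lambda>H. graph_iso_rel `` {H}) ` ?R" by blast
  qed
  then show "finite (?A // graph_iso_rel)"
    by (rule finite_subset) (intro finite_imageI finite_graphs_on finite_lessThan)
next
  fix d and G :: "'a pair_pre_digraph" assume "G \<in> bounded_alpha_graphs d"
  then show "\<exists>H\<in>(bounded_alpha_graphs d :: nat pair_pre_digraph set). digraph_iso (with_proj G) (with_proj H)"
    using bounded_alpha_graphs_representative by blast
qed

end
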